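(* Let $\mathcal{H}_d$ be a $d$-dimensional complex Hilbert space, and let $X\mapsto X^T$ denote transposition on $B(\mathcal{H}_d)$ with respect to a fixed orthonormal basis. For every $a\in[0,1]$, the map $\Psi_a:B(\mathcal{H}_d)\to B(\mathcal{H}_d)$, $$\Psi_a(X)=\frac{a}{d}\,\mathrm{Tr}(X)\,\mathbf{1}_d+(1-a)\,X^T,$$ is KS-decomposable.
   Context: $B(\mathcal{H}_d)$ is the algebra of linear operators on $\mathcal{H}_d$ and $\mathbf{1}_d$ its identity; operator inequalities are in the positive semidefinite order. A unital linear map $\Psi:B(\mathcal{H}_d)\to B(\mathcal{H}_d)$ is a Kadison--Schwarz (KS) operator if $\Psi(X^*X)\ge\Psi(X)^*\Psi(X)$ for all $X\in B(\mathcal{H}_d)$, and a co-Kadison--Schwarz (co-KS) operator if $\Psi(X^*X)\ge\Psi(X)\Psi(X)^*$ for all $X\in B(\mathcal{H}_d)$. A unital positive linear map $\Phi:B(\mathcal{H}_d)\to B(\mathcal{H}_d)$ is KS-decomposable if there exist a unital KS operator $\Phi_1$, a unital co-KS operator $\Phi_2$ and $\lambda\in[0,1]$ such that $\Phi=\lambda\Phi_1+(1-\lambda)\Phi_2$. *)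

theory Defs
  imports "HOL-Analysis.Analysis"
begin

text \<open>
  Operators on \<open>\<complex>\<^sup>d\<close> are represented by their matrices in the fixed orthonormal basis, indexed by
  a finite type \<open>'n\<close> with \<open>d = CARD('n)\<close>. Library addition, \<open>**\<close>, \<open>*v\<close>, \<open>mat 1\<close>, \<open>trace\<close> and
  \<open>transpose\<close> are the intended operator notions. The \<open>*\<close> of the type \<open>complex ^ 'n ^ 'n\<close> is
  componentwise, and the library inner product and \<open>adjoint\<close> on \<open>complex ^ 'n\<close> are
  the real ones; hence the following complex versions.
\<close>

type_synonym 'n operator = "complex ^ 'n ^ 'n"

definition cinner :: "complex ^ 'n \<Rightarrow> complex ^ 'n \<Rightarrow> complex" where
  "cinner u v = (\<Sum>i\<in>UNIV. cnj (u $ i) * v $ i)"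

definition cscale :: "complex \<Rightarrow> 'n::finite operator \<Rightarrow> 'n operator" where
  "cscale c A = (\<chi> i j. c * A $ i $ j)"

definition cadjoint :: "'n::finite operator \<Rightarrow> 'n operator" where
  "cadjoint A = (\<chi> i j. cnj (A $ j $ i))"

lemma cinner_cadjoint:
  fixes A :: "'n::finite operator"
  shows "cinner (cadjoint A *v u) v = cinner u (A *v v)"
proof -
  have "cinner (cadjoint A *v u) v
      = (\<Sum>i\<in>UNIV. \<Sum>j\<in>UNIV. A $ j $ i * cnj (u $ j) * v $ i)"
    by (simp add: cinner_def cadjoint_def matrix_vector_mult_def sum_distrib_right)
  also have "\<dots> = (\<Sum>j\<in>UNIV. \<Sum>i\<in>UNIV. A $ j $ i * cnj (u $ j) * v $ i)"
    by (rule sum.swap)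
  also have "\<dots> = cinner u (A *v v)"
    by (simp add: cinner_def matrix_vector_mult_def sum_distrib_left mult_ac)
  finally show ?thesis .
qed

lemma vector_space_cscale: "vector_space (cscale :: complex \<Rightarrow> 'n::finite operator \<Rightarrow> 'n operator)"
  by unfold_locales (simp_all add: cscale_def vec_eq_iff algebra_simps)

text \<open>
  Membership in \<open>\<real>\<^sub>\<ge>\<^sub>0\<close> asserts that the complex number is real and nonnegative; over
  \<open>\<complex>\<close> this already forces the operator to be Hermitian.
\<close>

definition pos_semidef :: "'n::finite operator \<Rightarrow> bool" where
  "pos_semidef A \<longleftrightarrow> (\<forall>v. cinner v (A *v v) \<in> \<real>\<^sub>\<ge>\<^sub>0)"

definition op_le :: "'n::finite operator \<Rightarrow> 'n operator \<Rightarrow> bool" (infix "\<preceq>" 50) where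
  "A \<preceq> B \<longleftrightarrow> pos_semidef (B - A)"

definition clinear_map :: "('n::finite operator \<Rightarrow> 'n operator) \<Rightarrow> bool" where
  "clinear_map \<Phi> \<longleftrightarrow> Vector_Spaces.linear cscale cscale \<Phi>"

definition unital :: "('n::finite operator \<Rightarrow> 'n operator) \<Rightarrow> bool" where
  "unital \<Phi> \<longleftrightarrow> \<Phi> (mat 1) = mat 1"

definition positive_map :: "('n::finite operator \<Rightarrow> 'n operator) \<Rightarrow> bool" where
  "positive_map \<Phi> \<longleftrightarrow> (\<forall>X. pos_semidef X \<longrightarrow> pos_semidef (\<Phi> X))"

definition KS_operator :: "('n::finite operator \<Rightarrow> 'n operator) \<Rightarrow> bool" where
  "KS_operator \<Psi> \<longleftrightarrow> clinear_map \<Psi> \<and> unital \<Psi> \<and>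
     (\<forall>X. cadjoint (\<Psi> X) ** \<Psi> X \<preceq> \<Psi> (cadjoint X ** X))"

definition co_KS_operator :: "('n::finite operator \<Rightarrow> 'n operator) \<Rightarrow> bool" where
  "co_KS_operator \<Psi> \<longleftrightarrow> clinear_map \<Psi> \<and> unital \<Psi> \<and>
     (\<forall>X. \<Psi> X ** cadjoint (\<Psi> X) \<preceq> \<Psi> (cadjoint X ** X))"

definition KS_decomposable :: "('n::finite operator \<Rightarrow> 'n operator) \<Rightarrow> bool" where
  "KS_decomposable \<Phi> \<longleftrightarrow> clinear_map \<Phi> \<and> unital \<Phi> \<and> positive_map \<Phi> \<and>
     (\<exists>\<Phi>\<^sub>1 \<Phi>\<^sub>2. \<exists>l\<in>{0..1::real}. KS_operator \<Phi>\<^sub>1 \<and> co_KS_operator \<Phi>\<^sub>2 \<and>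
        (\<forall>X. \<Phi> X = cscale (of_real l) (\<Phi>\<^sub>1 X) + cscale (of_real (1 - l)) (\<Phi>\<^sub>2 X)))"

end

theory Submission imports Defs begin

text \<open>
  The map is already written as a convex combination, with weight \<open>a\<close>, of the normalized trace
  \<open>X \<mapsto> (Tr X / d) 1\<close> and the transposition. The normalized trace is a Kadison--Schwarz operator:
  the required inequality between multiples of the identity is \<open>\<bar>Tr X\<bar>\<^sup>2 \<le> d Tr(X\<^sup>* X)\<close>, which is
  the Cauchy--Schwarz inequality on the diagonal of \<open>X\<close>
  (\<open>norm_trace_squared_le\<close>, \<open>KS_operator_normalized_trace\<close>). The transposition reverses products
  and commutes with the adjoint, so it satisfies the co-Kadison--Schwarz inequality with equality
  (\<open>co_KS_operator_transpose\<close>).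
\<close>

lemma clinear_mapI:
  assumes "\<And>X Y. \<Phi> (X + Y) = \<Phi> X + \<Phi> Y" and "\<And>c X. \<Phi> (cscale c X) = cscale c (\<Phi> X)"
  shows "clinear_map \<Phi>"
  using assms by (simp add: clinear_map_def Vector_Spaces.linear_iff vector_space_cscale)

lemma clinear_map_add: "clinear_map \<Phi> \<Longrightarrow> \<Phi> (X + Y) = \<Phi> X + \<Phi> Y"
  by (simp add: clinear_map_def Vector_Spaces.linear_iff)

lemma clinear_map_cscale: "clinear_map \<Phi> \<Longrightarrow> \<Phi> (cscale c X) = cscale c (\<Phi> X)"
  by (simp add: clinear_map_def Vector_Spaces.linear_iff)

lemma cscale_add_right: "cscale c (A + B) = cscale c A + cscale c B"
  by (simp add: cscale_def vec_eq_iff algebra_simps)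

lemma cscale_cscale: "cscale c (cscale b A) = cscale (c * b) A"
  by (simp add: cscale_def vec_eq_iff)

lemma clinear_map_combination:
  assumes "clinear_map \<Phi>" and "clinear_map \<Psi>"
  shows "clinear_map (\<lambda>X. cscale b (\<Phi> X) + cscale c (\<Psi> X))"
  using assms
  by (intro clinear_mapI)
    (simp_all add: clinear_map_add clinear_map_cscale cscale_add_right cscale_cscale mult.commute)

lemma cinner_add_right: "cinner u (v + w) = cinner u v + cinner u w"
  by (simp add: cinner_def distrib_left sum.distrib)

lemma cinner_cscale_mult: "cinner u (cscale c A *v v) = c * cinner u (A *v v)"
  by (simp add: cinner_def cscale_def matrix_vector_mult_def sum_distrib_left mult_ac)

lemma sum_nonneg_Reals: "(\<And>i. i \<in> I \<Longrightarrow> f i \<in> \<real>\<^sub>\<ge>\<^sub>0) \<Longrightarrow> sum f I \<in> \<real>\<^sub>\<ge>\<^sub>0"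
  by (induction I rule: infinite_finite_induct) auto

lemma cinner_self_nonneg: "cinner v v \<in> \<real>\<^sub>\<ge>\<^sub>0"
proof -
  have "cnj z * z \<in> \<real>\<^sub>\<ge>\<^sub>0" for z :: complex
    by (metis complex_norm_square mult.commute nonneg_Reals_of_real_iff zero_le_power2)
  then show ?thesis
    unfolding cinner_def by (intro sum_nonneg_Reals)
qed

lemma pos_semidef_mat_1: "pos_semidef (mat 1)"
  by (simp add: pos_semidef_def cinner_self_nonneg)

lemma pos_semidef_add: "pos_semidef A \<Longrightarrow> pos_semidef B \<Longrightarrow> pos_semidef (A + B)"
  by (simp add: pos_semidef_def matrix_vector_mult_add_rdistrib cinner_add_right)

lemma pos_semidef_cscale: "c \<in> \<real>\<^sub>\<ge>\<^sub>0 \<Longrightarrow> pos_semidef A \<Longrightarrow> pos_semidef (cscale c A)"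
  by (simp add: pos_semidef_def cinner_cscale_mult)

lemma op_le_refl: "A \<preceq> A"
  by (simp add: op_le_def pos_semidef_def cinner_def)

lemma positive_map_combination:
  assumes "positive_map \<Phi>" and "positive_map \<Psi>" and "b \<in> \<real>\<^sub>\<ge>\<^sub>0" and "c \<in> \<real>\<^sub>\<ge>\<^sub>0"
  shows "positive_map (\<lambda>X. cscale b (\<Phi> X) + cscale c (\<Psi> X))"
  using assms by (simp add: positive_map_def pos_semidef_add pos_semidef_cscale)

lemma pos_semidef_diagonal:
  assumes "pos_semidef A"
  shows "A $ i $ i \<in> \<real>\<^sub>\<ge>\<^sub>0"
proof -
  have "cinner (axis i 1) (A *v axis i 1) = A $ i $ i"
    by (simp add: cinner_def matrix_vector_mult_def axis_def if_distrib if_distribR cong: if_cong)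
  then show ?thesis
    using assms by (metis pos_semidef_def)
qed

lemma pos_semidef_trace: "pos_semidef A \<Longrightarrow> trace A \<in> \<real>\<^sub>\<ge>\<^sub>0"
  unfolding trace_def by (intro sum_nonneg_Reals pos_semidef_diagonal)

text \<open>The form of \<open>A\<^sup>T\<close> at \<open>v\<close> is the form of \<open>A\<close> at the entrywise conjugate of \<open>v\<close>.\<close>

lemma pos_semidef_transpose:
  fixes A :: "'n::finite operator"
  assumes "pos_semidef A"
  shows "pos_semidef (transpose A)"
  unfolding pos_semidef_def
proof
  fix v :: "complex ^ 'n"
  let ?w = "\<chi> i. cnj (v $ i)"
  have "cinner v (transpose A *v v) = (\<Sum>i\<in>UNIV. \<Sum>j\<in>UNIV. cnj (v $ i) * (A $ j $ i * v $ j))"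
    by (simp add: cinner_def matrix_vector_mult_def transpose_def sum_distrib_left)
  also have "\<dots> = (\<Sum>j\<in>UNIV. \<Sum>i\<in>UNIV. cnj (v $ i) * (A $ j $ i * v $ j))"
    by (rule sum.swap)
  also have "\<dots> = cinner ?w (A *v ?w)"
    by (simp add: cinner_def matrix_vector_mult_def sum_distrib_left mult_ac)
  finally show "cinner v (transpose A *v v) \<in> \<real>\<^sub>\<ge>\<^sub>0"
    using assms by (simp add: pos_semidef_def)
qed

lemma trace_cadjoint_mult:
  "trace (cadjoint X ** X) = of_real (\<Sum>i\<in>UNIV. \<Sum>j\<in>UNIV. (cmod (X $ j $ i))\<^sup>2)"
  unfolding of_real_sum complex_norm_square
  by (simp add: trace_def matrix_matrix_mult_def cadjoint_def mult.commute)

lemma norm_trace_squared_le: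
  fixes X :: "'n::finite operator"
  shows "(cmod (trace X))\<^sup>2 \<le> real CARD('n) * (\<Sum>i\<in>UNIV. \<Sum>j\<in>UNIV. (cmod (X $ j $ i))\<^sup>2)"
proof -
  have "(cmod (trace X))\<^sup>2 \<le> (\<Sum>i\<in>UNIV. cmod (X $ i $ i))\<^sup>2"
    unfolding trace_def by (intro power_mono norm_sum norm_ge_zero)
  also have "\<dots> \<le> real CARD('n) * (\<Sum>i\<in>UNIV. (cmod (X $ i $ i))\<^sup>2)"
    using Cauchy_Schwarz_ineq_sum[of "\<lambda>_. 1" "\<lambda>i. cmod (X $ i $ i)" UNIV] by simp
  also have "\<dots> \<le> real CARD('n) * (\<Sum>i\<in>UNIV. \<Sum>j\<in>UNIV. (cmod (X $ j $ i))\<^sup>2)"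
    by (intro mult_left_mono sum_mono member_le_sum) auto
  finally show ?thesis .
qed

text \<open>The map sending \<open>X\<close> to its normalized trace times the identity.\<close>

definition normalized_trace :: "'n::finite operator \<Rightarrow> 'n operator" where
  "normalized_trace X = cscale (trace X / of_nat CARD('n)) (mat 1)"

lemma clinear_map_normalized_trace:
  "clinear_map (normalized_trace :: 'n::finite operator \<Rightarrow> _)"
proof (rule clinear_mapI)
  show "normalized_trace (X + Y) = normalized_trace X + normalized_trace Y" for X Y :: "'n operator"
    by (simp add: normalized_trace_def cscale_def trace_add vec_eq_iff field_simps)
  show "normalized_trace (cscale c X) = cscale c (normalized_trace X)" for c and X :: "'n operator"
    by (simp add: normalized_trace_def cscale_def trace_def vec_eq_iff sum_distrib_left)
qed

lemma unital_normalized_trace: "unital normalized_trace"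
  by (simp add: unital_def normalized_trace_def cscale_def trace_I vec_eq_iff)

lemma positive_map_normalized_trace: "positive_map normalized_trace"
  unfolding positive_map_def normalized_trace_def
  by (intro allI impI pos_semidef_cscale pos_semidef_mat_1 nonneg_Reals_divide_I
      pos_semidef_trace nonneg_Reals_of_nat_I)

lemma cadjoint_cscale_mat_1: "cadjoint (cscale c (mat 1)) = cscale (cnj c) (mat 1)"
  by (auto simp: cadjoint_def cscale_def mat_def vec_eq_iff)

lemma cscale_matrix_mult: "cscale c A ** B = cscale c (A ** B)"
  by (simp add: cscale_def matrix_matrix_mult_def vec_eq_iff sum_distrib_left mult.assoc)

lemma cadjoint_mult_scalar:
  "cadjoint (cscale c (mat 1)) ** cscale c (mat 1) = cscale (of_real ((cmod c)\<^sup>2)) (mat 1)"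
  unfolding complex_norm_square
  by (simp only: cadjoint_cscale_mat_1 cscale_matrix_mult matrix_mul_lid cscale_cscale
      mult.commute)

lemma KS_operator_normalized_trace: "KS_operator (normalized_trace :: 'n::finite operator \<Rightarrow> _)"
proof -
  have "cadjoint (normalized_trace X) ** normalized_trace X \<preceq> normalized_trace (cadjoint X ** X)"
    for X :: "'n operator"
  proof -
    let ?d = "real CARD('n)" and ?s = "\<Sum>i\<in>UNIV. \<Sum>j\<in>UNIV. (cmod (X $ j $ i))\<^sup>2"
    have "(cmod (trace X / of_nat CARD('n)))\<^sup>2 \<le> ?s / ?d"
      using norm_trace_squared_le[of X]
      by (simp add: norm_divide power_divide field_simps power2_eq_square)
    then have "of_real (?s / ?d - (cmod (trace X / of_nat CARD('n)))\<^sup>2) \<in> (\<real>\<^sub>\<ge>\<^sub>0 :: complex set)"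
      by (simp only: nonneg_Reals_of_real_iff diff_ge_0_iff_ge)
    moreover have "normalized_trace (cadjoint X ** X)
        - cadjoint (normalized_trace X) ** normalized_trace X
        = cscale (of_real (?s / ?d - (cmod (trace X / of_nat CARD('n)))\<^sup>2)) (mat 1)"
      unfolding normalized_trace_def cadjoint_mult_scalar trace_cadjoint_mult
      by (simp add: cscale_def vec_eq_iff algebra_simps)
    ultimately show ?thesis
      by (simp only: op_le_def pos_semidef_cscale pos_semidef_mat_1)
  qed
  then show ?thesis
    by (simp add: KS_operator_def clinear_map_normalized_trace unital_normalized_trace)
qed

lemma co_KS_operator_transpose: "co_KS_operator (transpose :: 'n::finite operator \<Rightarrow> _)"
proof -
  have "clinear_map (transpose :: 'n operator \<Rightarrow> _)"
    by (rule clinear_mapI) (simp_all add: transpose_def cscale_def vec_eq_iff)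
  moreover have "transpose X ** cadjoint (transpose X) = transpose (cadjoint X ** X)"
    for X :: "'n operator"
    by (simp add: matrix_transpose_mul) (simp add: cadjoint_def transpose_def)
  ultimately show ?thesis
    by (simp add: co_KS_operator_def unital_def transpose_mat op_le_refl)
qed

text \<open>
  Positivity of the two summands is a separate hypothesis. It also follows from their
  Kadison--Schwarz inequalities by factoring positive semidefinite operators as \<open>X\<^sup>* X\<close>, but
  for the two maps used here it is immediate.
\<close>

lemma KS_decomposableI:
  assumes KS: "KS_operator \<Phi>\<^sub>1" and co_KS: "co_KS_operator \<Phi>\<^sub>2"
    and pos: "positive_map \<Phi>\<^sub>1" "positive_map \<Phi>\<^sub>2" and l: "l \<in> {0..1::real}"
  shows "KS_decomposable (\<lambda>X. cscale (of_real l) (\<Phi>\<^sub>1 X) + cscale (of_real (1 - l)) (\<Phi>\<^sub>2 X))"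
    (is "KS_decomposable ?\<Phi>")
proof -
  have "clinear_map ?\<Phi>"
    using KS co_KS by (simp only: KS_operator_def co_KS_operator_def clinear_map_combination)
  moreover have "unital ?\<Phi>"
    using KS co_KS
    by (simp add: KS_operator_def co_KS_operator_def unital_def cscale_def vec_eq_iff algebra_simps)
  moreover have "positive_map ?\<Phi>"
    using l by (intro positive_map_combination pos) (simp_all only: nonneg_Reals_of_real_iff, auto)
  ultimately show ?thesis
    unfolding KS_decomposable_def using KS co_KS l by blast
qed

theorem theorem4p3:
  fixes a :: real
  assumes "a \<in> {0..1}"
  shows "KS_decomposable (\<lambda>X :: complex ^ 'n::finite ^ 'n.
           cscale (of_real (a / real CARD('n)) * trace X) (mat 1)
           + cscale (of_real (1 - a)) (transpose X))"
proof -
  have "positive_map (transpose :: 'n operator \<Rightarrow> _)"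
    by (simp add: positive_map_def pos_semidef_transpose)
  with assms have "KS_decomposable (\<lambda>X :: 'n operator.
      cscale (of_real a) (normalized_trace X) + cscale (of_real (1 - a)) (transpose X))"
    by (intro KS_decomposableI KS_operator_normalized_trace co_KS_operator_transpose
        positive_map_normalized_trace)
  then show ?thesis
    by (simp add: normalized_trace_def cscale_cscale)
qed

end
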